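(* Let $(a_n)_{n\ge 0}$ and $(b_n)_{n\ge 0}$ be sequences of non-zero real numbers, and let $(x_n)_{n\ge -4}$ be a well-defined real solution of the difference equation $$x_{n+1}=\frac{x_{n}x_{n-2}x_{n-4}}{x_{n-1}x_{n-3}\,(a_{n}+b_{n}x_{n}x_{n-2}x_{n-4})},\qquad n=0,1,2,\dots$$ Then for all integers $n\ge 0$ and all $j\in\{0,1,2,3,4,5\}$, $$x_{6n+j-4}=x_{j-4}\prod_{k=0}^{n-1}\frac{\left(\prod_{k_1=0}^{6k+j-1}a_{k_1}\right)+x_{-4}x_{-2}x_{0}\sum_{l=0}^{6k+j-1}\left(b_l\prod_{k_2=l+1}^{6k+j-1}a_{k_2}\right)}{\left(\prod_{k_1=0}^{6k+j+1}a_{k_1}\right)+x_{-4}x_{-2}x_{0}\sum_{l=0}^{6k+j+1}\left(b_l\prod_{k_2=l+1}^{6k+j+1}a_{k_2}\right)}.$$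
   Context: A solution $(x_n)_{n\ge -4}$ with real initial values $x_{-4},x_{-3},x_{-2},x_{-1},x_0$ is called well-defined if for every $n\ge 0$ the denominator $x_{n-1}x_{n-3}(a_n+b_nx_nx_{n-2}x_{n-4})$ is non-zero, so that all terms are defined by the recurrence. Empty products are equal to $1$ and empty sums are equal to $0$. For $j=5$, the value $x_{j-4}=x_1$ is the one given by the recurrence with $n=0$. *)

theory Defs
  imports Complex_Main
begin

text \<open>
  A solution is an integer-indexed sequence of which only the values at indices
  \<open>\<ge> -4\<close> are relevant; smaller indices are unconstrained.
\<close>

definition denom :: "(nat \<Rightarrow> real) \<Rightarrow> (nat \<Rightarrow> real) \<Rightarrow> (int \<Rightarrow> real) \<Rightarrow> nat \<Rightarrow> real" where
  "denom a b x n =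
     x (int n - 1) * x (int n - 3) *
       (a n + b n * x (int n) * x (int n - 2) * x (int n - 4))"

definition is_solution :: "(nat \<Rightarrow> real) \<Rightarrow> (nat \<Rightarrow> real) \<Rightarrow> (int \<Rightarrow> real) \<Rightarrow> bool" where
  "is_solution a b x \<longleftrightarrow>
     (\<forall>n. x (int n + 1) = x (int n) * x (int n - 2) * x (int n - 4) / denom a b x n)"

definition well_defined :: "(nat \<Rightarrow> real) \<Rightarrow> (nat \<Rightarrow> real) \<Rightarrow> (int \<Rightarrow> real) \<Rightarrow> bool" where
  "well_defined a b x \<longleftrightarrow> (\<forall>n. denom a b x n \<noteq> 0)"

end

theory Submission imports Defs begin

text \<open>
  The products \<open>v m = x m * x (m - 2) * x (m - 4)\<close> turn the recurrence into the Riccati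
  equation \<open>v (m + 1) = v m / (a m + b m * v m)\<close>, which is linear in \<open>1 / v m\<close>. Hence
  \<open>v m = v 0 / D m\<close>, where \<open>D\<close> solves the affine recurrence
  \<open>D (m + 1) = a m * D m + v 0 * b m\<close> with \<open>D 0 = 1\<close>; variation of constants gives the
  explicit \<open>D m\<close> occurring as numerators and denominators of the formula.

  Two of the three factors of \<open>v (m + 2)\<close> and \<open>v m\<close> agree, so
  \<open>x (m + 2) / x (m - 4) = v (m + 2) / v m = D m / D (m + 2)\<close>. Multiplying these ratios
  along an arithmetic progression of step 6 gives the closed form. The divisions are
  legitimate because well-definedness forces all terms of index at least \<open>-4\<close> to be non-zero.
\<close>

definition affine_rec :: "(nat \<Rightarrow> 'a::comm_semiring_1) \<Rightarrow> (nat \<Rightarrow> 'a) \<Rightarrow> 'a \<Rightarrow> nat \<Rightarrow> 'a" where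
  "affine_rec a b c m =
     (\<Prod>i\<in>{0..<m}. a i) + c * (\<Sum>l\<in>{0..<m}. b l * (\<Prod>i\<in>{l+1..<m}. a i))"

definition triple_prod :: "(int \<Rightarrow> real) \<Rightarrow> nat \<Rightarrow> real" where
  "triple_prod x m = x (int m) * x (int m - 2) * x (int m - 4)"

lemma affine_rec_0: "affine_rec a b c 0 = 1"
  by (simp add: affine_rec_def)

lemma affine_rec_Suc: "affine_rec a b c (Suc m) = a m * affine_rec a b c m + c * b m"
proof -
  have "(\<Sum>l\<in>{0..<m}. b l * (\<Prod>i\<in>{l+1..<Suc m}. a i))
      = (\<Sum>l\<in>{0..<m}. a m * (b l * (\<Prod>i\<in>{l+1..<m}. a i)))"
    by (intro sum.cong) (auto simp: prod.atLeastLessThan_Suc mult_ac)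
  then show ?thesis
    by (simp add: affine_rec_def sum_distrib_left algebra_simps)
qed

text \<open>
  Terms of index at least \<open>-3\<close> are factors of some denominator. The initial value
  \<open>x (-4)\<close> is not, but if it vanished then so would \<open>x 1\<close>, which is such a factor.
\<close>

lemma well_defined_solution_nonzero:
  assumes "is_solution a b x" and "well_defined a b x"
  shows "x (int m - 4) \<noteq> 0"
proof (cases m)
  case 0
  have "denom a b x 2 \<noteq> 0"
    using assms(2) by (simp add: well_defined_def)
  then have "x 1 \<noteq> 0"
    by (simp add: denom_def)
  moreover have "x (int 0 + 1) = x (int 0) * x (int 0 - 2) * x (int 0 - 4) / denom a b x 0"
    using assms(1) unfolding is_solution_def by blast
  ultimately show ?thesis
    using 0 by auto
next
  case (Suc i)
  have "denom a b x i \<noteq> 0"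
    using assms(2) by (simp add: well_defined_def)
  moreover have "int m - 4 = int i - 3"
    using Suc by simp
  ultimately show ?thesis
    by (simp add: denom_def)
qed

lemma triple_prod_nonzero:
  assumes "is_solution a b x" and "well_defined a b x"
  shows "triple_prod x m \<noteq> 0"
  using well_defined_solution_nonzero[OF assms, of m]
    well_defined_solution_nonzero[OF assms, of "m + 2"]
    well_defined_solution_nonzero[OF assms, of "m + 4"]
  by (simp add: triple_prod_def)

text \<open>
  The factors \<open>x (m - 1) * x (m - 3)\<close> of the denominator complete \<open>x (m + 1)\<close> to the next
  triple product, so clearing denominators in the recurrence leaves the Riccati equation.
\<close>

lemma triple_prod_Suc:
  assumes "is_solution a b x" and "well_defined a b x"
  shows "triple_prod x (Suc m) * (a m + b m * triple_prod x m) = triple_prod x m"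
proof -
  have "x (int m + 1) * denom a b x m = triple_prod x m"
    using assms by (simp add: is_solution_def well_defined_def triple_prod_def)
  moreover have "int (Suc m) = int m + 1" "int (Suc m) - 2 = int m - 1" "int (Suc m) - 4 = int m - 3"
    by simp_all
  ultimately show ?thesis
    unfolding denom_def triple_prod_def by (simp only: mult_ac)
qed

lemma triple_prod_times_affine_rec:
  assumes "is_solution a b x" and "well_defined a b x"
  shows "triple_prod x m * affine_rec a b (triple_prod x 0) m = triple_prod x 0"
proof (induction m)
  case 0
  show ?case by (simp add: affine_rec_0)
next
  case (Suc m)
  let ?v = "triple_prod x" and ?D = "affine_rec a b (triple_prod x 0)"
  have "?v (Suc m) * ?D (Suc m) = ?v (Suc m) * (a m * ?D m + (?v m * ?D m) * b m)"
    by (simp add: affine_rec_Suc Suc.IH)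
  also have "\<dots> = (?v (Suc m) * (a m + b m * ?v m)) * ?D m"
    by (simp add: algebra_simps)
  also have "\<dots> = ?v 0"
    by (simp add: triple_prod_Suc[OF assms] Suc.IH)
  finally show ?case .
qed

lemma solution_step_6:
  assumes "is_solution a b x" and "well_defined a b x"
  defines "D \<equiv> affine_rec a b (triple_prod x 0)"
  shows "x (int m + 2) = x (int m - 4) * (D m / D (m + 2))"
proof -
  let ?v = "triple_prod x"
  have inv: "?v i * D i = ?v 0" for i
    unfolding D_def by (rule triple_prod_times_affine_rec[OF assms(1,2)])
  have v: "?v i \<noteq> 0" for i
    by (rule triple_prod_nonzero[OF assms(1,2)])
  have D: "D i \<noteq> 0" for i
    using inv[of i] v[of 0] by auto
  have "x (int m + 2) * ?v m = x (int m - 4) * ?v (m + 2)"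
    by (simp add: triple_prod_def algebra_simps)
  also have "?v (m + 2) = ?v m * (D m / D (m + 2))"
    using inv[of m] inv[of "m + 2"] D[of "m + 2"] by (simp add: field_simps)
  finally have "?v m * x (int m + 2) = ?v m * (x (int m - 4) * (D m / D (m + 2)))"
    by (simp only: mult_ac)
  then show ?thesis
    using mult_left_cancel[OF v] by blast
qed

theorem mainTheorem1:
  fixes a b :: "nat \<Rightarrow> real" and x :: "int \<Rightarrow> real" and n j :: nat
  assumes "\<And>m. a m \<noteq> 0" and "\<And>m. b m \<noteq> 0"
    and "is_solution a b x" and "well_defined a b x"
    and "j \<in> {0, 1, 2, 3, 4, 5}"
  shows "x (6 * int n + int j - 4) =
    x (int j - 4) *
    (\<Prod>k\<in>{0..<n}.
      ((\<Prod>k1\<in>{0..<6*k+j}. a k1)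
        + x (-4) * x (-2) * x 0 * (\<Sum>l\<in>{0..<6*k+j}. b l * (\<Prod>k2\<in>{l+1..<6*k+j}. a k2)))
      / ((\<Prod>k1\<in>{0..<6*k+j+2}. a k1)
        + x (-4) * x (-2) * x 0 * (\<Sum>l\<in>{0..<6*k+j+2}. b l * (\<Prod>k2\<in>{l+1..<6*k+j+2}. a k2))))"
proof -
  define D where "D = affine_rec a b (triple_prod x 0)"
  have D_eq: "D m = (\<Prod>k1\<in>{0..<m}. a k1)
      + x (-4) * x (-2) * x 0 * (\<Sum>l\<in>{0..<m}. b l * (\<Prod>k2\<in>{l+1..<m}. a k2))" for m
    by (simp add: D_def affine_rec_def triple_prod_def mult_ac)
  have "x (6 * int n + int j - 4) = x (int j - 4) * (\<Prod>k\<in>{0..<n}. D (6*k+j) / D (6*k+j+2))"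
  proof (induction n)
    case 0
    show ?case by simp
  next
    case (Suc n)
    have "6 * int (Suc n) + int j - 4 = int (6*n+j) + 2"
      and "int (6*n+j) - 4 = 6 * int n + int j - 4"
      by simp_all
    then have "x (6 * int (Suc n) + int j - 4)
        = x (6 * int n + int j - 4) * (D (6*n+j) / D (6*n+j+2))"
      using solution_step_6[OF assms(3,4), of "6*n+j"] by (simp only: D_def)
    then show ?case
      by (simp add: Suc.IH)
  qed
  then show ?thesis
    by (simp only: D_eq)
qed

end
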